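(* The Prime $k$-tuples Conjecture implies that there are infinitely many Lucas-Carmichael integers of degree $4$ with exactly five prime factors.
   Context: A Lucas-Carmichael integer is a square-free positive composite integer $n$ such that $p+1 \mid n+1$ for every prime $p$ dividing $n$. For an integer $b\ge 2$ and a positive integer $N$, $S_b(N)$ denotes the sum of the base-$b$ digits of $N$. The degree of a Lucas-Carmichael integer $n$ is the integer $\alpha = \max_{p\mid n} \frac{S_{p+2}(n+2)-1}{p+1}$, the maximum being over the prime divisors $p$ of $n$. Prime $k$-tuples Conjecture: Let $a_1,\ldots,a_k$ be positive integers, and let $b_1,\ldots,b_k$ be nonzero integers. For $m\ge 1$, define $f(m)=\prod_{i=1}^k (a_i m+b_i)$. Let $P(x)$ denote the number of positive integers $m\le x$ for which $a_i m+b_i$ is prime for each $i=1,\ldots,k$. The conjecture states that if no prime divides $f(m)$ for every $m$, then there exists $c>0$ such that $P(x)\sim \frac{cx}{\log^k x}$ as $x\to\infty$. *)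

theory Defs
  imports
    Complex_Main
    "HOL-Library.Landau_Symbols"
    "HOL-Computational_Algebra.Primes"
    "HOL-Computational_Algebra.Squarefree"
begin

definition lucas_carmichael :: "nat \<Rightarrow> bool" where
  "lucas_carmichael n \<longleftrightarrow>
     n > 1 \<and> \<not> prime n \<and> squarefree n \<and> (\<forall>p. prime p \<longrightarrow> p dvd n \<longrightarrow> p + 1 dvd n + 1)"

(* Intended for b >= 2. Then b ^ i > N for all i >= N, so the positions i < N
   include every nonzero digit of N. *)
definition digit_sum :: "nat \<Rightarrow> nat \<Rightarrow> nat" where
  "digit_sum b N = (\<Sum>i<N. N div b ^ i mod b)"

(* Real-valued, so that the quotients are exact and nothing is truncated. If n is a
   Lucas-Carmichael integer they are integers, since digit_sum (p + 2) (n + 2) is congruent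
   to n + 2, and hence to 1, modulo p + 1. *)
definition lc_degree :: "nat \<Rightarrow> real" where
  "lc_degree n =
     Max ((\<lambda>p. (real (digit_sum (p + 2) (n + 2)) - 1) / (real p + 1)) ` prime_factors n)"

(* The linear forms a i * m + b i are required to be pairwise distinct, as the conjecture
   tacitly assumes: a repeated form, such as k = 2 with both forms m + 1, would give
   P x ~ x / ln x instead of c * x / (ln x)^2, so the conjecture would be false and anything
   it implies vacuous. An implication from this version of the conjecture is the stronger one.
   Elements of type int that are prime are positive. *)
definition prime_k_tuples_conjecture :: bool where
  "prime_k_tuples_conjecture \<longleftrightarrow>
     (\<forall>(k::nat) (a :: nat \<Rightarrow> int) (b :: nat \<Rightarrow> int).
        k \<ge> 1 \<longrightarrow>
        (\<forall>i\<in>{1..k}. a i > 0 \<and> b i \<noteq> 0) \<longrightarrow>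
        inj_on (\<lambda>i. (a i, b i)) {1..k} \<longrightarrow>
        \<not> (\<exists>q::int. prime q \<and> (\<forall>m::nat. m \<ge> 1 \<longrightarrow> q dvd (\<Prod>i\<in>{1..k}. (a i * int m + b i)))) \<longrightarrow>
        (\<exists>c::real. c > 0 \<and>
           (\<lambda>x::real. real (card {m::nat. m \<ge> 1 \<and> real m \<le> x \<and>
                                    (\<forall>i\<in>{1..k}. prime (a i * int m + b i))}))
             \<sim>[at_top] (\<lambda>x. c * x / ln x ^ k)))"

end

theory Submission
  imports Defs "HOL-Number_Theory.Cong" "HOL-Real_Asymp.Real_Asymp"
begin

text \<open>
  Since $1/2 + 1/4 + 1/9 + 1/12 + 1/18 = 1$, each of $18, 9, 4, 3, 2$ divides their sum $36$.
  Hence if the five numbers $p_r = 432 r m - 1$, for $r = 18, 9, 4, 3, 2$, are prime, their product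
  $n$ satisfies $p_r + 1 \mid n + 1$. In base $b = p_r + 2$ each factor is
  $(r'/r) (b - 1) - 1$, so $n + 2$ is a polynomial in $b$ with rational coefficients; the factor
  $432 = 12 \cdot 36$ makes the carried fractions of $b - 1 = 432 r m$ integers, so that the digits
  are linear functions of $m$ once $m \ge 19$. Their sums are $1 + \alpha_r (p_r + 1)$ with
  $\alpha_r = 3, 2, 4, 3, 2$ respectively, so $n$ has degree $4$; as a digit sum
  in base $b$ is congruent to the number modulo $b - 1$, they also give $p_r + 1 \mid n + 1$ again,
  which is how it is proved here. As $q$ does not divide
  $\prod_r (432 r q - 1)$, the conjecture applies to the five linear forms.
\<close>

section \<open>Digit sums in a general base\<close>

text \<open>Positions from \<open>N\<close> on contribute 0 because \<open>b ^ i > N\<close> there;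
  a common cut-off lets the digit sums of different numbers be compared.\<close>

lemma digit_sum_eq_sum:
  assumes "b \<ge> 2" "N \<le> K"
  shows "digit_sum b N = (\<Sum>i<K. N div b ^ i mod b)"
  unfolding digit_sum_def
proof (rule sum.mono_neutral_left)
  show "\<forall>i\<in>{..<K} - {..<N}. N div b ^ i mod b = 0"
  proof
    fix i assume "i \<in> {..<K} - {..<N}"
    then have "N \<le> i" by simp
    also have "i < 2 ^ i" by (rule less_exp)
    also have "2 ^ i \<le> b ^ i" using assms(1) by (rule power_mono) simp
    finally show "N div b ^ i mod b = 0" by simp
  qed
qed (use assms in auto)

lemma digit_sum_step:
  assumes "b \<ge> 2" "d < b"
  shows "digit_sum b (d + b * N) = d + digit_sum b N"
proof -
  have "N \<le> b * N"
    using assms(1) by simp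
  then have le: "N \<le> d + b * N"
    by linarith
  have "digit_sum b (d + b * N) = (\<Sum>i<Suc (d + b * N). (d + b * N) div b ^ i mod b)"
    using assms(1) by (rule digit_sum_eq_sum) simp
  also have "\<dots> = d + (\<Sum>i<d + b * N. N div b ^ i mod b)"
    using assms by (subst sum.lessThan_Suc_shift) (simp add: div_mult2_eq)
  also have "(\<Sum>i<d + b * N. N div b ^ i mod b) = digit_sum b N"
    using digit_sum_eq_sum[OF assms(1) le] by simp
  finally show ?thesis .
qed

text \<open>Reads the digit sum off an exhibited digit list, least significant digit first, without
  any division; leading zeros do no harm.\<close>

lemma digit_sum_horner_sum:
  assumes "b \<ge> 2" "\<forall>d\<in>set ds. d < b"
  shows "digit_sum b (horner_sum id b ds) = sum_list ds"
  using assms(2)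
proof (induction ds)
  case Nil
  then show ?case by (simp add: digit_sum_def)
next
  case (Cons d ds)
  then show ?case using digit_sum_step[OF assms(1)] by simp
qed

text \<open>As \<open>b\<close> is 1 modulo \<open>b - 1\<close>, splitting off the last digit and
  replacing the factor \<open>b\<close> by 1 preserves the residue.\<close>

lemma cong_digit_sum:
  assumes "b \<ge> 2"
  shows "[digit_sum b N = N] (mod (b - 1))"
proof (induction N rule: less_induct)
  case (less N)
  show ?case
  proof (cases "N = 0")
    case True
    then show ?thesis by (simp add: digit_sum_def)
  next
    case False
    have b1: "[b = 1] (mod (b - 1))"
      using assms by (simp add: cong_altdef_nat)
    have "digit_sum b N = N mod b + digit_sum b (N div b)"
      using digit_sum_step[of b "N mod b" "N div b"] assms by simp
    also have "[\<dots> = N mod b + 1 * (N div b)] (mod (b - 1))"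
      using less.IH[of "N div b"] False assms by (simp add: cong_add_lcancel_nat)
    also have "[N mod b + 1 * (N div b) = N mod b + b * (N div b)] (mod (b - 1))"
      using b1 by (intro cong_add cong_mult) (auto simp: cong_sym_eq)
    finally show ?thesis by simp
  qed
qed

text \<open>For \<open>b = p + 2\<close> the modulus \<open>b - 1\<close> is \<open>p + 1\<close>,
  so \<open>n + 2\<close> is 1 modulo \<open>p + 1\<close>.\<close>

lemma succ_dvd_succ_of_digit_sum:
  assumes "digit_sum (p + 2) (n + 2) = 1 + \<alpha> * (p + 1)"
  shows "p + 1 dvd n + 1"
proof -
  have "[digit_sum (p + 2) (n + 2) = n + 2] (mod (p + 1))"
    using cong_digit_sum[of "p + 2" "n + 2"] by simp
  moreover have "[1 + \<alpha> * (p + 1) = 1 + 0] (mod (p + 1))"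
    by (intro cong_add) (simp_all only: cong_0_iff dvd_triv_right cong_refl)
  ultimately have "[1 + (n + 1) = 1 + 0] (mod (p + 1))"
    using assms by (metis add.assoc add.commute cong_sym cong_trans one_add_one)
  then show ?thesis
    using cong_add_lcancel_nat cong_0_iff by blast
qed

section \<open>Integers given by a list of distinct primes\<close>

lemma prime_factorization_prod_list_primes:
  fixes ps :: "nat list"
  assumes "\<forall>p\<in>set ps. prime p"
  shows "prime_factorization (prod_list ps) = mset ps"
  using assms by (metis prime_factorization_prod_mset_primes prod_mset_prod_list set_mset_mset)

lemma squarefree_prod_list_primes:
  fixes ps :: "nat list"
  assumes "\<forall>p\<in>set ps. prime p" "distinct ps"
  shows "squarefree (prod_list ps)"
proof -
  have "prod_list ps \<noteq> 0"
    using assms(1) by (auto simp: prod_list_zero_iff)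
  moreover have "multiplicity p (prod_list ps) \<le> 1" if "prime p" for p
    using that assms
    by (simp flip: count_prime_factorization_prime
        add: prime_factorization_prod_list_primes distinct_count_atmost_1 count_eq_zero_iff)
  ultimately show ?thesis
    by (subst squarefree_factorial_semiring'') auto
qed

text \<open>Reduces all three properties to digit sums: \<open>\<alpha> p\<close> is the quotient
  whose maximum is the degree.\<close>

lemma lucas_carmichael_degreeI:
  fixes ps :: "nat list"
  assumes "\<forall>p\<in>set ps. prime p" "distinct ps" "length ps \<ge> 2"
    and dsum: "\<And>p. p \<in> set ps \<Longrightarrow>
      digit_sum (p + 2) (prod_list ps + 2) = 1 + \<alpha> p * (p + 1)"
  shows "lucas_carmichael (prod_list ps)"
    and "lc_degree (prod_list ps) = real (Max (\<alpha> ` set ps))"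
    and "card (prime_factors (prod_list ps)) = length ps"
proof -
  let ?n = "prod_list ps"
  have pf: "prime_factorization ?n = mset ps"
    using assms(1) by (rule prime_factorization_prod_list_primes)
  have ne: "?n \<noteq> 0" using assms(1) by (auto simp: prod_list_zero_iff)
  have "\<not> prime ?n"
    \<comment> \<open>A prime would have a factorization of size 1.\<close>
    using assms(3) pf prime_factorization_prime[of ?n] by (metis Suc_1 not_less_eq_eq order_refl
        size_mset size_single One_nat_def)
  moreover have "?n \<noteq> 1"
    using assms(3) pf by auto
  moreover have "p + 1 dvd ?n + 1" if "prime p" "p dvd ?n" for p
  proof -
    have "p \<in> prime_factors ?n"
      using that ne by (simp add: prime_factors_dvd)
    then show ?thesis
      using succ_dvd_succ_of_digit_sum dsum unfolding pf set_mset_mset by blast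
  qed
  ultimately show "lucas_carmichael ?n"
    unfolding lucas_carmichael_def
    using ne squarefree_prod_list_primes[OF assms(1,2)] by auto
  have "(real (digit_sum (p + 2) (?n + 2)) - 1) / (real p + 1) = real (\<alpha> p)"
    if "p \<in> set ps" for p
    using dsum[OF that] by (simp add: field_simps add_eq_0_iff)
  then have deg: "lc_degree ?n = Max ((\<lambda>p. real (\<alpha> p)) ` set ps)"
    unfolding lc_degree_def pf set_mset_mset by (simp cong: image_cong)
  have "ps \<noteq> []"
    using assms(3) by auto
  then have "Max ((\<lambda>p. real (\<alpha> p)) ` set ps) = real (Max (\<alpha> ` set ps))"
    using mono_Max_commute[of real "\<alpha> ` set ps"]
    by (auto simp: image_image mono_def)
  with deg show "lc_degree ?n = real (Max (\<alpha> ` set ps))"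
    by simp
  show "card (prime_factors ?n) = length ps"
    unfolding pf using assms(2) by (simp add: distinct_card)
qed

section \<open>A qualitative consequence of the conjecture\<close>

text \<open>The predicted count tends to infinity, whereas a finite solution set would bound
  it.\<close>

lemma prime_k_tuples_infinite:
  fixes a b :: "nat \<Rightarrow> int"
  assumes "prime_k_tuples_conjecture" "k \<ge> 1"
    and "\<forall>i\<in>{1..k}. a i > 0 \<and> b i \<noteq> 0" "inj_on (\<lambda>i. (a i, b i)) {1..k}"
    and "\<not> (\<exists>q::int. prime q \<and> (\<forall>m::nat. m \<ge> 1 \<longrightarrow> q dvd (\<Prod>i\<in>{1..k}. (a i * int m + b i))))"
  shows "infinite {m::nat. \<forall>i\<in>{1..k}. prime (a i * int m + b i)}" (is "infinite ?S")
proof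
  assume fin: "finite ?S"
  let ?P = "\<lambda>x::real. real (card {m::nat. m \<ge> 1 \<and> real m \<le> x \<and>
                              (\<forall>i\<in>{1..k}. prime (a i * int m + b i))})"
  obtain c :: real where c: "c > 0" and P: "?P \<sim>[at_top] (\<lambda>x. c * x / ln x ^ k)"
    using assms unfolding prime_k_tuples_conjecture_def by blast
  have "filterlim (\<lambda>x. c * x / ln x ^ k) at_top at_top"
    using c by real_asymp
  then have "filterlim ?P at_top at_top"
    using P asymp_equiv_at_top_transfer asymp_equiv_sym by blast
  then have "eventually (\<lambda>x. ?P x > real (card ?S)) at_top"
    by (simp only: filterlim_at_top_dense)
  moreover have "?P x \<le> real (card ?S)" for x
    using fin by (intro of_nat_mono card_mono) auto
  ultimately show False
    by (simp add: not_less[symmetric])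
qed

section \<open>The family of five linear forms\<close>

text \<open>
  The numbers $p_r$ for $m = k + 19$: from this point on the digits below have nonnegative
  coefficients, so no subtraction on the natural numbers is needed.
\<close>

definition lc_factors :: "nat \<Rightarrow> nat list" where
  "lc_factors k = [7776 * k + 147743, 3888 * k + 73871, 1728 * k + 32831,
     1296 * k + 24623, 864 * k + 16415]"

text \<open>Once the digits are exhibited, each claim amounts to a polynomial identity in
  \<open>k\<close> and linear inequalities.\<close>

lemma digit_sum_lc_factors:
  defines "n \<equiv> \<lambda>k. prod_list (lc_factors k)"
  shows "digit_sum (7776 * k + 147743 + 2) (n k + 2) = 1 + 3 * (7776 * k + 147743 + 1)"
    and "digit_sum (3888 * k + 73871 + 2) (n k + 2) = 1 + 2 * (3888 * k + 73871 + 1)"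
    and "digit_sum (1728 * k + 32831 + 2) (n k + 2) = 1 + 4 * (1728 * k + 32831 + 1)"
    and "digit_sum (1296 * k + 24623 + 2) (n k + 2) = 1 + 3 * (1296 * k + 24623 + 1)"
    and "digit_sum (864 * k + 16415 + 2) (n k + 2) = 1 + 2 * (864 * k + 16415 + 1)"
proof -
  have *: "digit_sum b N = s"
    if "N = horner_sum id b ds" "b \<ge> 2" "\<forall>d\<in>set ds. d < b" "sum_list ds = s" for b N s ds
    using digit_sum_horner_sum that by blast
  show "digit_sum (7776 * k + 147743 + 2) (n k + 2) = 1 + 3 * (7776 * k + 147743 + 1)"
    \<comment> \<open>In base \<open>p_r + 2\<close>, the coefficient of the fifth power is the
      product of the ratios r'/r. It is below 1 for r = 18 and 9, leaving only five digits.\<close>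
    by (rule *[where ds = "[5856 * k + 111262, 6016 * k + 114310, 4088 * k + 77669,
          7352 * k + 139689, 16 * k + 303]"])
      (simp_all add: n_def lc_factors_def algebra_simps)
  show "digit_sum (3888 * k + 73871 + 2) (n k + 2) = 1 + 2 * (3888 * k + 73871 + 1)"
    by (rule *[where ds = "[480 * k + 9108, 784 * k + 14923, 2384 * k + 45277,
          3872 * k + 73575, 256 * k + 4862]"])
      (simp_all add: n_def lc_factors_def algebra_simps)
  show "digit_sum (1728 * k + 32831 + 2) (n k + 2) = 1 + 4 * (1728 * k + 32831 + 1)"
    by (rule *[where ds = "[1458 * k + 27611, 1161 * k + 22319, 1485 * k + 27934,
          1431 * k + 27337, 1377 * k + 26125, 3]"])
      (simp_all add: n_def lc_factors_def algebra_simps)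
  show "digit_sum (1296 * k + 24623 + 2) (n k + 2) = 1 + 3 * (1296 * k + 24623 + 1)"
    \<comment> \<open>The ratios have product 16; the next coefficient is negative and borrows 1,
      leaving 15.\<close>
    by (rule *[where ds = "[1008 * k + 18937, 432 * k + 8878, 1152 * k + 21078, 480,
          1296 * k + 24485, 15]"])
      (simp_all add: n_def lc_factors_def algebra_simps)
  show "digit_sum (864 * k + 16415 + 2) (n k + 2) = 1 + 2 * (864 * k + 16415 + 1)"
    \<comment> \<open>The digit \<open>216 * k + 140\<close> is \<open>216 * m - 3964\<close>; its
      sign is what forces \<open>m \<ge> 19\<close>.\<close>
    by (rule *[where ds = "[864 * k + 15594, 2874, 216 * k + 140, 216 * k + 6807,
          432 * k + 7297, 121]"])
      (simp_all add: n_def lc_factors_def algebra_simps)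
qed

lemma lc_factors_lucas_carmichael:
  assumes "\<forall>p\<in>set (lc_factors k). prime p"
  defines "n \<equiv> prod_list (lc_factors k)"
  shows "lucas_carmichael n \<and> lc_degree n = 4 \<and> card (prime_factors n) = 5"
proof -
  define \<alpha> :: "nat \<Rightarrow> nat" where
    \<comment> \<open>The default 2 serves r = 9 and r = 2.\<close>
    "\<alpha> p = (if p \<in> {7776 * k + 147743, 1296 * k + 24623} then 3
            else if p = 1728 * k + 32831 then 4 else 2)" for p
  have dist: "distinct (lc_factors k)"
    by (simp add: lc_factors_def)
  have len: "length (lc_factors k) = 5"
    by (simp add: lc_factors_def)
  have "digit_sum (p + 2) (n + 2) = 1 + \<alpha> p * (p + 1)" if "p \<in> set (lc_factors k)" for p
  proof -
    consider "p = 7776 * k + 147743" | "p = 3888 * k + 73871" | "p = 1728 * k + 32831"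
      | "p = 1296 * k + 24623" | "p = 864 * k + 16415"
      using \<open>p \<in> set (lc_factors k)\<close> by (auto simp: lc_factors_def)
    then show ?thesis
      by cases (simp_all only: n_def digit_sum_lc_factors, simp_all add: \<alpha>_def)
  qed
  note * = lucas_carmichael_degreeI[OF assms(1) dist _ this[unfolded n_def]]
  have "Max (\<alpha> ` set (lc_factors k)) = 4"
    by (simp add: lc_factors_def \<alpha>_def)
  then show ?thesis
    using * len by (simp add: n_def)
qed

text \<open>Ensures that distinct \<open>k\<close> give distinct integers.\<close>

lemma strict_mono_lc_factors: "strict_mono (\<lambda>k. prod_list (lc_factors k))"
proof (rule strict_monoI)
  fix k l :: nat assume "k < l"
  then show "prod_list (lc_factors k) < prod_list (lc_factors l)"
    unfolding lc_factors_def prod_list.Cons prod_list.Nil mult_1_right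
    by (intro mult_strict_mono) simp_all
qed

lemma infinite_lc_factors_primes:
  assumes "prime_k_tuples_conjecture"
  shows "infinite {k. \<forall>p\<in>set (lc_factors k). prime p}"
proof -
  define a :: "nat \<Rightarrow> int" where "a i = [7776, 3888, 1728, 1296, 864] ! (i - 1)" for i
  have five: "{1..5::nat} = {1, 2, 3, 4, 5}"
    by auto
  have a: "a 1 = 7776" "a (Suc 0) = 7776" "a 2 = 3888" "a 3 = 1728" "a 4 = 1296" "a 5 = 864"
    by (simp_all add: a_def)
  \<comment> \<open>At \<open>m = q\<close> every form is -1 modulo \<open>q\<close>.\<close>
  have not_dvd: "\<not> q dvd (\<Prod>i\<in>{1..5}. (a i * int (nat q) + - 1))" if q: "prime q" for q :: int
  proof
    assume "q dvd (\<Prod>i\<in>{1..5}. (a i * int (nat q) + - 1))"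
    then obtain i where "q dvd a i * int (nat q) + - 1"
      using q by (auto simp: prime_dvd_prod_iff)
    then have "q dvd a i * q - 1"
      using prime_gt_0_int[OF q] by simp
    then have "q dvd a i * q - (a i * q - 1)"
      using dvd_diff dvd_triv_right by blast
    then have "is_unit q"
      by simp
    then show False
      using q not_prime_unit by blast
  qed
  have "\<exists>m\<ge>1. \<not> q dvd (\<Prod>i\<in>{1..5}. (a i * int m + - 1))" if "prime q" for q :: int
  proof (intro exI conjI)
    show "1 \<le> nat q"
      using prime_ge_1_int[OF that] by simp
  qed (rule not_dvd[OF that])
  then have no_divisor: "\<not> (\<exists>q::int. prime q \<and> (\<forall>m\<ge>1. q dvd (\<Prod>i\<in>{1..5}. (a i * int m + - 1))))"
    by blast
  have pos: "\<forall>i\<in>{1..5}. a i > 0 \<and> (- 1 :: int) \<noteq> 0" and inj: "inj_on (\<lambda>i. (a i, - 1 :: int)) {1..5}"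
    unfolding five by (simp_all add: a)
  let ?S = "{m::nat. \<forall>i\<in>{1..5}. prime (a i * int m + - 1)}"
  have "infinite ?S"
    by (rule prime_k_tuples_infinite[OF assms _ pos inj no_divisor]) simp
  \<comment> \<open>Dropping finitely many \<open>m\<close> permits the substitution
    \<open>m = k + 19\<close>.\<close>
  then have "infinite (?S - {..<19})"
    by simp
  moreover have "?S - {..<19} \<subseteq> (\<lambda>k. k + 19) ` {k. \<forall>p\<in>set (lc_factors k). prime p}"
  proof
    fix m assume m: "m \<in> ?S - {..<19}"
    define k where "k = m - 19"
    have k: "m = k + 19"
      using m by (simp add: k_def)
    have "int ` set (lc_factors k) = (\<lambda>i. a i * int m + - 1) ` {1..5}"
      unfolding five by (simp add: a k lc_factors_def add.commute)
    then have "\<forall>p\<in>int ` set (lc_factors k). prime p"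
      using m by simp
    then have "\<forall>p\<in>set (lc_factors k). prime p"
      by simp
    then show "m \<in> (\<lambda>k. k + 19) ` {k. \<forall>p\<in>set (lc_factors k). prime p}"
      using k by blast
  qed
  ultimately show ?thesis
    by (meson finite_subset finite_imageI)
qed

theorem theorem4p4:
  assumes "prime_k_tuples_conjecture"
  shows "infinite {n::nat. lucas_carmichael n \<and> lc_degree n = 4 \<and> card (prime_factors n) = 5}"
proof -
  let ?n = "\<lambda>k. prod_list (lc_factors k)"
  have "infinite (?n ` {k. \<forall>p\<in>set (lc_factors k). prime p})"
    using infinite_lc_factors_primes[OF assms] strict_mono_lc_factors
    by (simp add: finite_image_iff strict_mono_on_imp_inj_on strict_mono_imp_inj_on inj_on_subset)
  then show ?thesis
    by (rule infinite_super[rotated]) (auto dest: lc_factors_lucas_carmichael)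
qed

end
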